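(* Consider a process under measurements and feedback control as described in the context, with no initial correlation between the system and the measurement outcomes. Define the unavailable information of the protocol $\Lambda[Y]$ by $$I_{{\rm u}|\Lambda[Y]}=-\ln(1-\lambda_{{\rm S}|\Lambda[Y]})\ (\ge0).$$ Then, writing $I_{\rm u}=I_{{\rm u}|\Lambda[Y]}$, $$\langle e^{-\sigma-I+I_{\rm u}}\rangle_{|Y}=1,$$ and, averaging over $Y$, $$\langle e^{-\sigma-I+I_{\rm u}}\rangle=1.$$ This equality leads to $$\langle\sigma\rangle\ge-\langle I-I_{\rm u}\rangle.$$ This inequality is stronger than $\langle\sigma\rangle\ge-\langle I\rangle-\ln(1-\overline{\lambda}_{\rm S})$, because, by the convexity of $-\ln x$, $$\langle I_{\rm u}\rangle=\langle-\ln(1-\lambda_{{\rm S}|\Lambda[Y]})\rangle\ge-\ln(1-\overline{\lambda}_{\rm S}).$$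
   Context: $X$ denotes the entire path of the system, $Y$ the entire record of measurement outcomes (a random variable), and $\Lambda[Y]$ the entire path of the control parameter, which is determined by the outcomes $Y$. For each $Y$ there are three probability measures on system paths: $\mathcal{M}_{|Y}$, the conditional probability measure of $X$ given the outcomes $Y$; $\mathcal{M}^{\rm tr}_{|\Lambda[Y]}$, the transition probability measure of $X$ under the fixed protocol $\Lambda[Y]$; and $\mathcal{M}^{\rm r}_{|\Lambda[Y]}$, the probability measure of $X$ in a reference process under the protocol $\Lambda[Y]$. For each $Y$, $\mathcal{M}^{\rm r}_{|\Lambda[Y]}=\mathcal{M}^{\rm r}_{{\rm AC}|\Lambda[Y]}+\mathcal{M}^{\rm r}_{{\rm S}|\Lambda[Y]}$ is the Lebesgue decomposition with respect to $\mathcal{M}_{|Y}$ into absolutely continuous and singular parts, $\lambda_{{\rm S}|\Lambda[Y]}=\int\mathcal{M}^{\rm r}_{{\rm S}|\Lambda[Y]}[dX]$ is the probability of the singular part, and $\overline{\lambda}_{\rm S}$ is the average of $\lambda_{{\rm S}|\Lambda[Y]}$ over $Y$. It is assumed that $\mathcal{M}^{\rm r}_{{\rm AC}|\Lambda[Y]}$ is absolutely continuous with respect to $\mathcal{M}^{\rm tr}_{|\Lambda[Y]}$ and that $\mathcal{M}^{\rm tr}_{|\Lambda[Y]}$ is absolutely continuous with respect to $\mathcal{M}_{|Y}$. The entropy production $\sigma$ and, in the absence of initial correlation, the total mutual information $I$ obtained by the measurements are given by the Radon–Nikodym derivatives $$e^{-\sigma}=\frac{d\mathcal{M}^{\rm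 r}_{{\rm AC}|\Lambda[Y]}}{d\mathcal{M}^{\rm tr}_{|\Lambda[Y]}}(X),\qquad e^{-I}=\frac{d\mathcal{M}^{\rm tr}_{|\Lambda[Y]}}{d\mathcal{M}_{|Y}}(X).$$ Averages: $\langle\cdot\rangle_{|Y}$ is the average over $\mathcal{M}_{|Y}$, and $\langle\cdot\rangle$ is the average of $\langle\cdot\rangle_{|Y}$ over the outcomes $Y$.
   Formalization: The equality given Y is stated when the singular probability is below 1, and the averaged equality, the second-law inequality and the comparison of bounds when this holds for almost every Y, since otherwise the unavailable information is -ln 0 and the equality is undefined. *)

theory Defs
  imports "HOL-Probability.Probability"
begin

text \<open>Exponential and logarithm with the values \<open>e\<^sup>-\<^sup>\<infinity> = 0\<close> and \<open>ln 0 = -\<infinity>\<close>: Radon--Nikodym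
  densities may vanish, so entropy production and information may take the value \<open>\<infinity>\<close>.\<close>

definition exp_ereal :: "ereal \<Rightarrow> ereal" where
  "exp_ereal x = (if x = \<infinity> then \<infinity> else if x = -\<infinity> then 0 else ereal (exp (real_of_ereal x)))"

text \<open>Only meant for \<open>x \<ge> 0\<close>.\<close>

definition ln_ereal :: "real \<Rightarrow> ereal" where
  "ln_ereal x = (if x = 0 then -\<infinity> else ereal (ln x))"

text \<open>The average of an extended-real function as the difference of the integrals of its positive
  and negative parts (\<open>e2ennreal\<close> truncates negative values to 0). It is meaningful only if at
  least one of the two integrals is finite, which is what \<open>avg_exists\<close> says.\<close>

definition avg :: "'a measure \<Rightarrow> ('a \<Rightarrow> ereal) \<Rightarrow> ereal" where
  "avg M f = enn2ereal (\<integral>\<^sup>+ x. e2ennreal (f x) \<partial>M) - enn2ereal (\<integral>\<^sup>+ x. e2ennreal (- f x) \<partial>M)"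

definition avg_exists :: "'a measure \<Rightarrow> ('a \<Rightarrow> ereal) \<Rightarrow> bool" where
  "avg_exists M f \<longleftrightarrow> f \<in> borel_measurable M \<and>
     ((\<integral>\<^sup>+ x. e2ennreal (f x) \<partial>M) < \<infinity> \<or> (\<integral>\<^sup>+ x. e2ennreal (- f x) \<partial>M) < \<infinity>)"

text \<open>For the law \<open>Q\<close> of the outcomes and the conditional law \<open>K y\<close> of the system path given the
  outcomes \<open>y\<close>: \<open>full_avg Q K f\<close> averages over \<open>y\<close> the average of \<open>f y\<close> over \<open>K y\<close>.\<close>

definition full_avg :: "'y measure \<Rightarrow> ('y \<Rightarrow> 'x measure) \<Rightarrow> ('y \<Rightarrow> 'x \<Rightarrow> ereal) \<Rightarrow> ereal" where
  "full_avg Q K f = avg Q (\<lambda>y. avg (K y) (f y))"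

definition full_avg_exists :: "'y measure \<Rightarrow> ('y \<Rightarrow> 'x measure) \<Rightarrow> ('y \<Rightarrow> 'x \<Rightarrow> ereal) \<Rightarrow> bool" where
  "full_avg_exists Q K f \<longleftrightarrow>
     (AE y in Q. avg_exists (K y) (f y)) \<and> avg_exists Q (\<lambda>y. avg (K y) (f y))"

definition conditional_law ::
  "'w measure \<Rightarrow> ('w \<Rightarrow> 'x) \<Rightarrow> 'x measure \<Rightarrow> ('w \<Rightarrow> 'y) \<Rightarrow> 'y measure \<Rightarrow> ('y \<Rightarrow> 'x measure) \<Rightarrow> bool" where
  "conditional_law P X MX Y MY K \<longleftrightarrow> K \<in> MY \<rightarrow>\<^sub>M prob_algebra MX \<and>
     (\<forall>A\<in>sets MX. \<forall>B\<in>sets MY.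
        emeasure P {w \<in> space P. X w \<in> A \<and> Y w \<in> B} = (\<integral>\<^sup>+ y\<in>B. emeasure (K y) A \<partial>distr P MY Y))"

definition singular_measure :: "'a measure \<Rightarrow> 'a measure \<Rightarrow> bool" where
  "singular_measure M N \<longleftrightarrow> (\<exists>A\<in>sets M. emeasure M A = 0 \<and> emeasure N (space M - A) = 0)"

text \<open>\<open>N = AC + S\<close> is the Lebesgue decomposition of \<open>N\<close> with respect to \<open>M\<close>. In the library's
  convention \<open>absolutely_continuous M AC\<close> means that \<open>AC\<close> is absolutely continuous with respect
  to \<open>M\<close>.\<close>

definition lebesgue_decomposition ::
  "'a measure \<Rightarrow> 'a measure \<Rightarrow> 'a measure \<Rightarrow> 'a measure \<Rightarrow> bool" where
  "lebesgue_decomposition M N AC S \<longleftrightarrow>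
     sets AC = sets N \<and> sets S = sets N \<and>
     (\<forall>A\<in>sets N. emeasure N A = emeasure AC A + emeasure S A) \<and>
     absolutely_continuous M AC \<and> singular_measure M S"

text \<open>\<open>exp (- s)\<close> is a version of the Radon--Nikodym derivative \<open>dN/dM\<close> with values in
  \<open>[0, \<infinity>)\<close>. The values of \<open>s\<close> on an \<open>M\<close>-null set are otherwise arbitrary; they can matter because
  \<open>s\<close> may be averaged over a measure that is not absolutely continuous with respect to \<open>M\<close>.\<close>

definition neg_log_density :: "'a measure \<Rightarrow> 'a measure \<Rightarrow> ('a \<Rightarrow> ereal) \<Rightarrow> bool" where
  "neg_log_density M N s \<longleftrightarrow> (\<forall>x\<in>space M. s x \<noteq> -\<infinity>) \<and>
     (AE x in M. exp_ereal (- s x) = enn2ereal (RN_deriv M N x))"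

text \<open>In the next two definitions \<open>S\<close> is the singular part of the reference measure.\<close>

definition singular_prob :: "'a measure \<Rightarrow> real" where
  "singular_prob S = measure S (space S)"

definition unavailable_info :: "'a measure \<Rightarrow> ereal" where
  "unavailable_info S = - ln_ereal (1 - singular_prob S)"

end

theory Submission
  imports Defs
begin

text \<open>The chain rule for densities gives \<open>\<integral> e\<^bsup>-\<sigma>-I\<^esup> dM\<^bsub>|Y\<^esub> = 1 - \<lambda>\<^sub>S\<close> for each outcome. Outcomes of
  positive conditional but zero transition probability do not contribute, because there
  \<open>I = \<infinity>\<close> while \<open>\<sigma> > -\<infinity>\<close>. The same identity shows that \<open>\<lambda>\<^sub>S\<close> is measurable in \<open>Y\<close>. The second law
  follows from \<open>1 - e\<^sup>-\<^sup>t \<le> t\<close>, which also bounds the negative parts of \<open>\<sigma>\<close> and \<open>I\<close>, so that the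
  only infinities left are harmless. The comparison of the bounds is Jensen's inequality for
  \<open>- ln\<close>, applied through the tangent at \<open>1 - \<lambda>\<^sub>S\<close> averaged over \<open>Y\<close>.\<close>

section \<open>Extended exponential and averages of extended-real functions\<close>

lemma exp_ereal_measurable [measurable]: "exp_ereal \<in> borel_measurable borel"
  unfolding exp_ereal_def by measurable

lemma exp_ereal_nonneg [simp]: "0 \<le> exp_ereal x"
  by (simp add: exp_ereal_def)

text \<open>The value \<open>\<infinity>\<close> is excluded because
  \<open>\<infinity> + (-\<infinity>) = \<infinity>\<close> in \<open>ereal\<close>, whereas
  \<open>\<infinity> * 0 = 0\<close> in \<open>ennreal\<close>. The value
  \<open>-\<infinity>\<close> is harmless: both sides are then 0.\<close>

lemma exp_ereal_add:
  assumes "a \<noteq> \<infinity>" "b \<noteq> \<infinity>"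
  shows "e2ennreal (exp_ereal (a + b)) = e2ennreal (exp_ereal a) * e2ennreal (exp_ereal b)"
  using assms by (cases a; cases b) (auto simp: exp_ereal_def exp_add ennreal_mult)

lemma avg_nonneg_eq:
  assumes "AE x in M. 0 \<le> f x"
  shows "avg M f = enn2ereal (\<integral>\<^sup>+ x. e2ennreal (f x) \<partial>M)"
proof -
  have "(\<integral>\<^sup>+ x. e2ennreal (- f x) \<partial>M) = (\<integral>\<^sup>+ x. 0 \<partial>M)"
    using assms by (intro nn_integral_cong_AE) (auto elim!: eventually_mono simp: e2ennreal_neg)
  then show ?thesis by (simp add: avg_def zero_ennreal.rep_eq)
qed

text \<open>Subtraction on \<open>ereal\<close> is total and monotone in the expected directions,
  infinite values included, so comparing positive and negative parts suffices even where
  \<open>avg_exists\<close> fails.\<close>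

lemma avg_mono_AE:
  assumes "AE x in M. f x \<le> g x"
  shows "avg M f \<le> avg M g"
  unfolding avg_def
  by (intro ereal_minus_mono less_eq_ennreal.rep_eq[THEN iffD1] nn_integral_mono_AE)
     (use assms in \<open>auto elim!: eventually_mono intro!: e2ennreal_mono\<close>)

lemma avg_cong_AE:
  assumes "AE x in M. f x = g x"
  shows "avg M f = avg M g"
  using assms by (intro antisym avg_mono_AE) (auto elim!: eventually_mono)

text \<open>Equality fails only if both parts have infinite integral: since
  \<open>\<infinity> - \<infinity> = \<infinity>\<close>, the left side is then
  \<open>-\<infinity>\<close> and the right side \<open>\<infinity>\<close>.\<close>

lemma uminus_avg_le: "- avg M f \<le> avg M (\<lambda>x. - f x)"
  unfolding avg_def
  by (cases "enn2ereal (\<integral>\<^sup>+ x. e2ennreal (f x) \<partial>M)"; cases "enn2ereal (\<integral>\<^sup>+ x. e2ennreal (- f x) \<partial>M)") auto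

lemma (in prob_space) avg_const: "avg M (\<lambda>x. c) = c"
  by (cases c) (auto simp: avg_def emeasure_space_1 ennreal.rep_eq max_def e2ennreal_neg zero_ennreal.rep_eq)

lemma avg_ereal:
  assumes "integrable M h"
  shows "avg M (\<lambda>x. ereal (h x)) = ereal (\<integral>x. h x \<partial>M)"
proof -
  have "(\<integral>\<^sup>+ x. ennreal (h x) \<partial>M) < \<infinity>" "(\<integral>\<^sup>+ x. ennreal (- h x) \<partial>M) < \<infinity>"
    using assms by (auto simp: real_integrable_def less_top)
  then obtain p n where "(\<integral>\<^sup>+ x. ennreal (h x) \<partial>M) = ennreal p" "0 \<le> p"
    "(\<integral>\<^sup>+ x. ennreal (- h x) \<partial>M) = ennreal n" "0 \<le> n"
    by (metis ennreal_cases infinity_ennreal_def less_irrefl)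
  then show ?thesis
    using real_lebesgue_integral_def[OF assms] by (simp add: avg_def ennreal.rep_eq)
qed

text \<open>Bridge to the Bochner integral: once both parts are finite, the extended-real function
  may be replaced by a real integrable one.\<close>

lemma avg_integrable:
  assumes f: "f \<in> borel_measurable M"
    and p: "(\<integral>\<^sup>+ x. e2ennreal (f x) \<partial>M) < \<infinity>" and n: "(\<integral>\<^sup>+ x. e2ennreal (- f x) \<partial>M) < \<infinity>"
  shows "AE x in M. f x = ereal (real_of_ereal (f x))"
    and "integrable M (\<lambda>x. real_of_ereal (f x))"
    and "avg M f = ereal (\<integral>x. real_of_ereal (f x) \<partial>M)"
proof -
  note [measurable] = f
  have "AE x in M. e2ennreal (f x) \<noteq> \<infinity>" "AE x in M. e2ennreal (- f x) \<noteq> \<infinity>"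
    using nn_integral_PInf_AE[of "\<lambda>x. e2ennreal (f x)" M] nn_integral_PInf_AE[of "\<lambda>x. e2ennreal (- f x)" M] p n by auto
  then show fin: "AE x in M. f x = ereal (real_of_ereal (f x))"
    by eventually_elim (case_tac "f x", auto)
  have "(\<integral>\<^sup>+ x. e2ennreal (f x) \<partial>M) = (\<integral>\<^sup>+ x. ennreal (real_of_ereal (f x)) \<partial>M)"
    using fin by (intro nn_integral_cong_AE) (auto elim!: eventually_mono, metis e2ennreal_ereal)
  moreover have "(\<integral>\<^sup>+ x. e2ennreal (- f x) \<partial>M) = (\<integral>\<^sup>+ x. ennreal (- real_of_ereal (f x)) \<partial>M)"
    using fin by (intro nn_integral_cong_AE) (auto elim!: eventually_mono, metis e2ennreal_ereal uminus_ereal.simps(1))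
  ultimately show int: "integrable M (\<lambda>x. real_of_ereal (f x))"
    using p n by (simp add: real_integrable_def less_top[symmetric])
  show "avg M f = ereal (\<integral>x. real_of_ereal (f x) \<partial>M)"
    using avg_ereal[OF int] avg_cong_AE[OF fin] by simp
qed

section \<open>The second-law inequality from a bound on the exponential average\<close>

text \<open>In the application the exponential has average 1, so a finite positive part of \<open>b\<close> forces a
  finite negative part of \<open>a\<close>.\<close>

lemma e2ennreal_uminus_le_exp: "e2ennreal (- a) \<le> e2ennreal (exp_ereal (- a - b)) + e2ennreal b"
proof (cases a)
  case (real r)
  show ?thesis
  proof (cases b)
    case (real t)
    \<comment> \<open>The tangent bound \<open>exp u \<ge> 1 + u\<close> at
      \<open>u = - r - t\<close>. The \<open>max\<close> appears because \<open>ennreal\<close>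
      truncates a negative \<open>t\<close> to 0.\<close>
    have "ennreal (- r) \<le> ennreal (exp (- r - t) + max 0 t)"
      using exp_ge_add_one_self[of "- r - t"] by (intro ennreal_leI) linarith
    also have "\<dots> = ennreal (exp (- r - t)) + ennreal t"
      by (subst ennreal_plus) (auto simp: max_def ennreal_neg)
    finally show ?thesis using \<open>a = ereal r\<close> real by (simp add: exp_ereal_def)
  qed (use real in \<open>auto simp: exp_ereal_def\<close>)
next
  case MInf
  then show ?thesis by (cases b) (auto simp: exp_ereal_def)
qed (auto simp: e2ennreal_neg)

text \<open>Since \<open>\<infinity> - \<infinity> = \<infinity>\<close> in \<open>ereal\<close>, \<open>avg\<close> is \<open>\<infinity>\<close> as soon as the positive part has integral \<open>\<infinity>\<close>;
  those cases are trivial.\<close>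

lemma (in prob_space) avg_ge_uminus_avg:
  assumes f [measurable]: "f \<in> borel_measurable M" and g [measurable]: "g \<in> borel_measurable M"
    and le: "(\<integral>\<^sup>+ x. e2ennreal (exp_ereal (- f x - g x)) \<partial>M) \<le> 1"
  shows "- avg M g \<le> avg M f"
proof -
  consider "(\<integral>\<^sup>+ x. e2ennreal (f x) \<partial>M) = \<infinity>" | "(\<integral>\<^sup>+ x. e2ennreal (g x) \<partial>M) = \<infinity>"
    | (fin) "(\<integral>\<^sup>+ x. e2ennreal (f x) \<partial>M) < \<infinity>" "(\<integral>\<^sup>+ x. e2ennreal (g x) \<partial>M) < \<infinity>"
    by (metis less_top infinity_ennreal_def)
  then show ?thesis
  proof cases
    case fin
    have "(\<integral>\<^sup>+ x. e2ennreal (- f x) \<partial>M)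
        \<le> (\<integral>\<^sup>+ x. e2ennreal (exp_ereal (- f x - g x)) + e2ennreal (g x) \<partial>M)"
      by (intro nn_integral_mono e2ennreal_uminus_le_exp)
    also have "\<dots> \<le> 1 + (\<integral>\<^sup>+ x. e2ennreal (g x) \<partial>M)"
      using le by (subst nn_integral_add) (auto intro: add_mono)
    also have "\<dots> < \<infinity>" using fin by simp
    finally have nf: "(\<integral>\<^sup>+ x. e2ennreal (- f x) \<partial>M) < \<infinity>" .
    \<comment> \<open>The hypothesis is symmetric in \<open>f\<close> and \<open>g\<close>, so the
      same bound applies with the roles exchanged.\<close>
    have "(\<integral>\<^sup>+ x. e2ennreal (- g x) \<partial>M)
        \<le> (\<integral>\<^sup>+ x. e2ennreal (exp_ereal (- f x - g x)) + e2ennreal (f x) \<partial>M)"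
      using e2ennreal_uminus_le_exp[of "g _" "f _"]
      by (intro nn_integral_mono) (simp add: minus_ereal_def add.commute)
    also have "\<dots> \<le> 1 + (\<integral>\<^sup>+ x. e2ennreal (f x) \<partial>M)"
      using le by (subst nn_integral_add) (auto intro: add_mono)
    also have "\<dots> < \<infinity>" using fin by simp
    finally have ng: "(\<integral>\<^sup>+ x. e2ennreal (- g x) \<partial>M) < \<infinity>" .
    define u where "u x = real_of_ereal (f x)" for x
    define v where "v x = real_of_ereal (g x)" for x
    have u: "AE x in M. f x = ereal (u x)" "integrable M u" "avg M f = ereal (\<integral>x. u x \<partial>M)"
      using avg_integrable[OF f fin(1) nf] by (simp_all add: u_def[abs_def])
    have v: "AE x in M. g x = ereal (v x)" "integrable M v" "avg M g = ereal (\<integral>x. v x \<partial>M)"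
      using avg_integrable[OF g fin(2) ng] by (simp_all add: v_def[abs_def])
    note [measurable] = borel_measurable_integrable[OF u(2)] borel_measurable_integrable[OF v(2)]
    have "(\<integral>\<^sup>+ x. ennreal (exp (- u x - v x)) \<partial>M) = (\<integral>\<^sup>+ x. e2ennreal (exp_ereal (- f x - g x)) \<partial>M)"
      using u(1) v(1)
      by (intro nn_integral_cong_AE, eventually_elim) (simp add: exp_ereal_def)
    with le have e: "(\<integral>\<^sup>+ x. ennreal (exp (- u x - v x)) \<partial>M) \<le> 1" by simp
    then have int: "integrable M (\<lambda>x. exp (- u x - v x))"
      by (intro integrableI_nonneg) (auto simp: less_top intro: le_less_trans[OF e])
    have "ennreal (\<integral>x. exp (- u x - v x) \<partial>M) \<le> 1"
      using e by (subst (asm) nn_integral_eq_integral[OF int]) auto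
    \<comment> \<open>The total mass 1 of \<open>M\<close> turns this into the integral of
      \<open>1 - exp (- t)\<close> with \<open>t = u x + v x\<close>, which is at most
      \<open>t\<close> pointwise.\<close>
    then have "0 \<le> 1 - (\<integral>x. exp (- u x - v x) \<partial>M)" by simp
    also have "\<dots> = (\<integral>x. 1 - exp (- u x - v x) \<partial>M)"
      using int by (simp add: prob_space)
    also have "\<dots> \<le> (\<integral>x. u x + v x \<partial>M)"
    proof (intro integral_mono)
      show "1 - exp (- u x - v x) \<le> u x + v x" for x
        using exp_ge_add_one_self[of "- u x - v x"] by linarith
    qed (use int u(2) v(2) in auto)
    also have "\<dots> = (\<integral>x. u x \<partial>M) + (\<integral>x. v x \<partial>M)" using u v by simp
    finally show ?thesis by (simp add: u v)
  qed (auto simp: avg_def)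
qed

section \<open>Averages of differences and Jensen's inequality\<close>

lemma ennreal_le_add_diff: "ennreal a \<le> ennreal b + ennreal (a - b)"
  by (cases "0 \<le> b"; cases "b \<le> a")
     (auto simp: ennreal_neg simp flip: ennreal_plus intro!: ennreal_leI)

text \<open>Only an inequality can hold: for \<open>f = c\<close> finite-valued with infinite
  integral, the left side is 0 and the right side
  \<open>\<infinity> - \<infinity> = \<infinity>\<close>.\<close>

lemma avg_diff_le:
  assumes f [measurable]: "f \<in> borel_measurable M" and c [measurable]: "c \<in> borel_measurable M"
    and n: "(\<integral>\<^sup>+ x. e2ennreal (- f x) \<partial>M) < \<infinity>"
    and nonneg: "\<And>x. x \<in> space M \<Longrightarrow> 0 \<le> c x"
  shows "avg M (\<lambda>x. f x - c x) \<le> avg M f - avg M c"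
proof -
  have c0: "(\<integral>\<^sup>+ x. e2ennreal (- c x) \<partial>M) = 0"
    using nonneg by (subst nn_integral_cong[of _ _ "\<lambda>_. 0"]) (auto simp: e2ennreal_neg)
  consider "(\<integral>\<^sup>+ x. e2ennreal (f x) \<partial>M) = \<infinity>"
    | (inf) "(\<integral>\<^sup>+ x. e2ennreal (f x) \<partial>M) < \<infinity>" "(\<integral>\<^sup>+ x. e2ennreal (c x) \<partial>M) = \<infinity>"
    | (fin) "(\<integral>\<^sup>+ x. e2ennreal (f x) \<partial>M) < \<infinity>" "(\<integral>\<^sup>+ x. e2ennreal (c x) \<partial>M) < \<infinity>"
    by (metis less_top infinity_ennreal_def)
  then show ?thesis
  proof cases
    case inf
    \<comment> \<open>Truncation at 0 is subadditive, applied to \<open>c = f + (c - f)\<close>. The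
      finite positive part of \<open>f\<close> therefore forces an infinite negative part of
      \<open>f - c\<close>, and the left average is \<open>-\<infinity>\<close>.\<close>
    have "(\<integral>\<^sup>+ x. e2ennreal (c x) \<partial>M) \<le> (\<integral>\<^sup>+ x. e2ennreal (f x) + e2ennreal (- (f x - c x)) \<partial>M)"
    proof (intro nn_integral_mono)
      fix x assume "x \<in> space M"
      then show "e2ennreal (c x) \<le> e2ennreal (f x) + e2ennreal (- (f x - c x))"
        using nonneg[of x] ennreal_le_add_diff by (cases "f x"; cases "c x") auto
    qed
    also have "\<dots> = (\<integral>\<^sup>+ x. e2ennreal (f x) \<partial>M) + (\<integral>\<^sup>+ x. e2ennreal (- (f x - c x)) \<partial>M)"
      by (rule nn_integral_add) auto
    finally have "(\<integral>\<^sup>+ x. e2ennreal (- (f x - c x)) \<partial>M) = \<infinity>"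
      using inf by (auto simp: top_unique less_top)
    moreover have "(\<integral>\<^sup>+ x. e2ennreal (f x - c x) \<partial>M) \<le> (\<integral>\<^sup>+ x. e2ennreal (f x) \<partial>M)"
      using nonneg by (intro nn_integral_mono e2ennreal_mono) (simp add: ereal_diff_le_self)
    then have "(\<integral>\<^sup>+ x. e2ennreal (f x - c x) \<partial>M) < \<infinity>"
      using inf(1) by (rule le_less_trans)
    ultimately show ?thesis
      by (cases "\<integral>\<^sup>+ x. e2ennreal (f x - c x) \<partial>M") (auto simp: avg_def ennreal.rep_eq)
  next
    case fin
    note F = avg_integrable[OF f fin(1) n]
    have "(\<integral>\<^sup>+ x. e2ennreal (- c x) \<partial>M) < \<infinity>" by (simp add: c0)
    note C = avg_integrable[OF c fin(2) this]
    have "avg M (\<lambda>x. f x - c x) = avg M (\<lambda>x. ereal (real_of_ereal (f x) - real_of_ereal (c x)))"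
      by (rule avg_cong_AE) (use F(1) C(1) in \<open>eventually_elim, metis ereal_minus(1)\<close>)
    also have "\<dots> = avg M f - avg M c"
      using F C by (subst avg_ereal) auto
    finally show ?thesis by simp
  qed (auto simp: avg_def)
qed

lemma (in prob_space) ln_ereal_jensen:
  assumes l [measurable]: "l \<in> borel_measurable M" and b: "\<And>x. x \<in> space M \<Longrightarrow> 0 \<le> l x \<and> l x \<le> 1"
  shows "- ln_ereal (1 - (\<integral>x. l x \<partial>M)) \<le> avg M (\<lambda>x. - ln_ereal (1 - l x))"
proof -
  let ?c = "\<lambda>x. - ln_ereal (1 - l x)"
  have meas [measurable]: "?c \<in> borel_measurable M" unfolding ln_ereal_def by measurable
  have nonneg: "0 \<le> ?c x" if "x \<in> space M" for x
    using b[OF that] by (auto simp: ln_ereal_def)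
  have c0: "(\<integral>\<^sup>+ x. e2ennreal (- ?c x) \<partial>M) = 0"
    using nonneg by (subst nn_integral_cong[of _ _ "\<lambda>_. 0"]) (auto simp: e2ennreal_neg)
  have intl: "integrable M l" using b by (intro integrable_const_bound[where B=1]) auto
  show ?thesis
  proof (cases "(\<integral>\<^sup>+ x. e2ennreal (?c x) \<partial>M) < \<infinity>")
    case True
    note C = avg_integrable[OF meas True]
    \<comment> \<open>Where \<open>l x = 1\<close> the integrand is \<open>\<infinity>\<close>,
      which a finite average permits only on a null set. This makes \<open>m\<close> positive, so
      that \<open>- ln\<close> has a tangent there.\<close>
    have lt: "AE x in M. l x < 1"
      using C(1) c0 AE_space
      by (simp, elim AE_mp) (use b in \<open>auto simp: ln_ereal_def less_le\<close>)
    define m where "m = 1 - (\<integral>x. l x \<partial>M)"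
    have m: "0 < m" using expectation_less[OF intl lt] by (simp add: m_def)
    \<comment> \<open>The integrand is the tangent of \<open>- ln\<close> at \<open>m\<close>,
      evaluated at \<open>1 - l x\<close>; its linear term integrates to 0 because \<open>m\<close>
      is the mean of \<open>1 - l\<close>.\<close>
    have "- ln m = (\<integral>x. - ln m - ((1 - l x) - m) / m \<partial>M)"
      using intl by (simp add: prob_space m_def)
    also have "\<dots> \<le> (\<integral>x. real_of_ereal (?c x) \<partial>M)"
    proof (intro integral_mono_AE)
      show "AE x in M. - ln m - ((1 - l x) - m) / m \<le> real_of_ereal (?c x)"
        using lt
      proof eventually_elim
        case (elim x)
        have "ln ((1 - l x) / m) \<le> (1 - l x) / m - 1"
          using elim m by (intro ln_le_minus_one) auto
        then show ?case using elim m by (simp add: ln_ereal_def ln_div field_simps)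
      qed
    qed (use intl C c0 in auto)
    finally show ?thesis using C(3) c0 m by (simp add: ln_ereal_def m_def)
  qed (auto simp: avg_def c0 zero_ennreal.rep_eq less_top[symmetric])
qed

section \<open>Chain rule for densities and the masses of the Lebesgue decomposition\<close>

lemma nn_integral_neg_log_density:
  assumes "sigma_finite_measure M" "absolutely_continuous M N" "sets N = sets M"
    and s: "neg_log_density M N s" and f: "f \<in> borel_measurable M"
  shows "(\<integral>\<^sup>+ x. f x \<partial>N) = (\<integral>\<^sup>+ x. e2ennreal (exp_ereal (- s x)) * f x \<partial>M)"
proof -
  interpret sigma_finite_measure M by fact
  have "(\<integral>\<^sup>+ x. f x \<partial>N) = (\<integral>\<^sup>+ x. RN_deriv M N x * f x \<partial>M)"
    using assms by (intro RN_deriv_nn_integral)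
  also have "\<dots> = (\<integral>\<^sup>+ x. e2ennreal (exp_ereal (- s x)) * f x \<partial>M)"
    using s unfolding neg_log_density_def
    by (intro nn_integral_cong_AE) (auto elim!: eventually_mono)
  finally show ?thesis .
qed

text \<open>The change of measure is applied twice, from \<open>N\<close> to \<open>T\<close> with
  the function 1 and from \<open>T\<close> to \<open>K\<close> with the density just
  obtained.\<close>

lemma nn_integral_exp_neg_log_densities:
  assumes K: "sigma_finite_measure K" and T: "sigma_finite_measure T"
    and ac: "absolutely_continuous T N" "absolutely_continuous K T"
    and sets: "sets N = sets T" "sets T = sets K"
    and [measurable]: "s \<in> borel_measurable K"
    and s: "neg_log_density T N s" and i: "neg_log_density K T i"
  shows "(\<integral>\<^sup>+ x. e2ennreal (exp_ereal (- s x - i x)) \<partial>K) = emeasure N (space N)"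
proof -
  have sp: "space N = space T" "space T = space K"
    using sets[THEN sets_eq_imp_space_eq] by simp_all
  have meas: "(\<lambda>x. e2ennreal (exp_ereal (- s x))) \<in> borel_measurable K" by measurable
  have "emeasure N (space N) = (\<integral>\<^sup>+ x. 1 \<partial>N)" by simp
  also have "\<dots> = (\<integral>\<^sup>+ x. e2ennreal (exp_ereal (- s x)) \<partial>T)"
    using nn_integral_neg_log_density[OF T ac(1) sets(1) s, of "\<lambda>_. 1"] by simp
  also have "\<dots> = (\<integral>\<^sup>+ x. e2ennreal (exp_ereal (- i x)) * e2ennreal (exp_ereal (- s x)) \<partial>K)"
    using nn_integral_neg_log_density[OF K ac(2) sets(2) i meas] .
  also have "\<dots> = (\<integral>\<^sup>+ x. e2ennreal (exp_ereal (- s x - i x)) \<partial>K)"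
  proof (intro nn_integral_cong)
    fix x assume "x \<in> space K"
    \<comment> \<open>\<open>s\<close> represents a density only up to \<open>T\<close>-null sets,
      which may have positive \<open>K\<close>-measure. Excluding \<open>-\<infinity>\<close> at
      every point keeps the product 0 where \<open>i x = \<infinity>\<close>.\<close>
    then have "- s x \<noteq> \<infinity>" "- i x \<noteq> \<infinity>"
      using s i sp by (auto simp: neg_log_density_def ereal_uminus_eq_reorder)
    then show "e2ennreal (exp_ereal (- i x)) * e2ennreal (exp_ereal (- s x))
        = e2ennreal (exp_ereal (- s x - i x))"
      by (simp add: minus_ereal_def exp_ereal_add mult.commute)
  qed
  finally show ?thesis by simp
qed

text \<open>Additivity of the decomposition on the whole space makes the two masses sum to 1; both
  are then finite and can be handled as reals.\<close>

lemma lebesgue_decomposition_mass: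
  assumes "prob_space N" "lebesgue_decomposition M N AC S"
  shows "0 \<le> singular_prob S" "singular_prob S \<le> 1"
    and "emeasure AC (space AC) = ennreal (1 - singular_prob S)"
proof -
  interpret N: prob_space N by fact
  have sets: "sets AC = sets N" "sets S = sets N"
    and eq: "\<And>A. A \<in> sets N \<Longrightarrow> emeasure N A = emeasure AC A + emeasure S A"
    using assms by (auto simp: lebesgue_decomposition_def)
  note sp = sets[THEN sets_eq_imp_space_eq]
  have sum: "emeasure AC (space AC) + emeasure S (space S) = 1"
    using eq[OF sets.top] by (simp add: N.emeasure_space_1 sp)
  then have "emeasure AC (space AC) \<le> 1" "emeasure S (space S) \<le> 1"
    by (metis le_iff_add add.commute)+
  then obtain a b where ab: "emeasure AC (space AC) = ennreal a" "0 \<le> a"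
      "emeasure S (space S) = ennreal b" "0 \<le> b"
    by (metis ennreal_cases ennreal_one_neq_top top_unique)
  with sum have "a + b = 1"
    by (simp flip: ennreal_plus)
  then show "0 \<le> singular_prob S" "singular_prob S \<le> 1"
    "emeasure AC (space AC) = ennreal (1 - singular_prob S)"
    using ab by (auto simp: singular_prob_def measure_def)
qed

theorem mainTheorem6:
  fixes P :: "'w measure" and MX :: "'x measure" and MY :: "'y measure"
    and X :: "'w \<Rightarrow> 'x" and Y :: "'w \<Rightarrow> 'y" and Q :: "'y measure"
    and \<Lambda> :: "'y \<Rightarrow> 'l"
    and Mcond :: "'y \<Rightarrow> 'x measure" and Mtr Mref :: "'l \<Rightarrow> 'x measure"
    and Mac Msing :: "'y \<Rightarrow> 'x measure"
    and \<sigma> I :: "'y \<Rightarrow> 'x \<Rightarrow> ereal"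
  assumes "prob_space P"
    and "X \<in> P \<rightarrow>\<^sub>M MX" and "Y \<in> P \<rightarrow>\<^sub>M MY"
    and "Q = distr P MY Y"
    and "conditional_law P X MX Y MY Mcond"
    and "\<And>y. y \<in> space MY \<Longrightarrow> prob_space (Mtr (\<Lambda> y)) \<and> sets (Mtr (\<Lambda> y)) = sets MX"
    and "\<And>y. y \<in> space MY \<Longrightarrow> prob_space (Mref (\<Lambda> y)) \<and> sets (Mref (\<Lambda> y)) = sets MX"
    and "\<And>y. y \<in> space MY \<Longrightarrow> lebesgue_decomposition (Mcond y) (Mref (\<Lambda> y)) (Mac y) (Msing y)"
    and "\<And>y. y \<in> space MY \<Longrightarrow> absolutely_continuous (Mtr (\<Lambda> y)) (Mac y)"
    and "\<And>y. y \<in> space MY \<Longrightarrow> absolutely_continuous (Mcond y) (Mtr (\<Lambda> y))"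
    and "case_prod \<sigma> \<in> borel_measurable (MY \<Otimes>\<^sub>M MX)"
    and "case_prod I \<in> borel_measurable (MY \<Otimes>\<^sub>M MX)"
    and "\<And>y. y \<in> space MY \<Longrightarrow> neg_log_density (Mtr (\<Lambda> y)) (Mac y) (\<sigma> y)"
    and "\<And>y. y \<in> space MY \<Longrightarrow> neg_log_density (Mcond y) (Mtr (\<Lambda> y)) (I y)"
  shows "(\<forall>y\<in>space MY. 0 \<le> unavailable_info (Msing y)) \<and>
    (\<forall>y\<in>space MY. singular_prob (Msing y) < 1 \<longrightarrow>
       avg (Mcond y) (\<lambda>x. exp_ereal (- \<sigma> y x - I y x + unavailable_info (Msing y))) = 1) \<and>
    ((AE y in Q. singular_prob (Msing y) < 1) \<longrightarrow>
       full_avg Q Mcond (\<lambda>y x. exp_ereal (- \<sigma> y x - I y x + unavailable_info (Msing y))) = 1 \<and>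
       (full_avg_exists Q Mcond \<sigma> \<and>
        full_avg_exists Q Mcond (\<lambda>y x. I y x - unavailable_info (Msing y)) \<longrightarrow>
          full_avg Q Mcond \<sigma> \<ge> - full_avg Q Mcond (\<lambda>y x. I y x - unavailable_info (Msing y))) \<and>
       - full_avg Q Mcond (\<lambda>y x. I y x - unavailable_info (Msing y))
          \<ge> - full_avg Q Mcond I - ln_ereal (1 - (\<integral>y. singular_prob (Msing y) \<partial>Q))) \<and>
    full_avg Q Mcond (\<lambda>y x. unavailable_info (Msing y))
       = avg Q (\<lambda>y. - ln_ereal (1 - singular_prob (Msing y))) \<and>
    avg Q (\<lambda>y. - ln_ereal (1 - singular_prob (Msing y)))
       \<ge> - ln_ereal (1 - (\<integral>y. singular_prob (Msing y) \<partial>Q))"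
proof -

  \<comment> \<open>Kernels, sections and the singular mass\<close>
  note [measurable] = assms(11,12)
  interpret P: prob_space P by (rule assms(1))
  interpret Q: prob_space Q using P.prob_space_distr[OF assms(3)] assms(4) by simp
  have setsQ [measurable_cong]: "sets Q = sets MY" and spQ: "space Q = space MY"
    using assms(4) by simp_all
  have Kmeas: "Mcond \<in> MY \<rightarrow>\<^sub>M prob_algebra MX" using assms(5) by (simp add: conditional_law_def)
  note Ksub [measurable] = measurable_prob_algebraD[OF Kmeas]
  have K: "prob_space (Mcond y)" "sets (Mcond y) = sets MX" if "y \<in> space MY" for y
    using measurable_space[OF Kmeas that] by (auto simp: space_prob_algebra)
  have slice: "\<sigma> y \<in> borel_measurable (Mcond y)" "I y \<in> borel_measurable (Mcond y)"
    if "y \<in> space MY" for y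
    using measurable_compose[OF measurable_Pair1'[OF that] assms(11)]
      measurable_compose[OF measurable_Pair1'[OF that] assms(12)]
    by (simp_all add: measurable_cong_sets[OF K(2)[OF that] refl])
  define l where "l y = singular_prob (Msing y)" for y
  have l01: "0 \<le> l y" "l y \<le> 1" and AC: "emeasure (Mac y) (space (Mac y)) = ennreal (1 - l y)"
    if "y \<in> space MY" for y
    using lebesgue_decomposition_mass[OF _ assms(8)[OF that]] assms(7)[OF that] by (auto simp: l_def)
  have Iu: "unavailable_info (Msing y) = - ln_ereal (1 - l y)" for y
    by (simp add: unavailable_info_def l_def)
  have Iu_nonneg: "0 \<le> unavailable_info (Msing y)" if "y \<in> space MY" for y
    using l01[OF that] by (auto simp: Iu ln_ereal_def)

  \<comment> \<open>The fluctuation theorem for a fixed outcome\<close>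
  have exp_int: "(\<integral>\<^sup>+ x. e2ennreal (exp_ereal (- \<sigma> y x - I y x)) \<partial>Mcond y) = ennreal (1 - l y)"
    if y: "y \<in> space MY" for y
  proof -
    have "sets (Mac y) = sets MX"
      using assms(7,8)[OF y] by (simp add: lebesgue_decomposition_def)
    then show ?thesis
      unfolding AC[OF y, symmetric] using assms(6,9,10,13,14)[OF y] slice[OF y] K[OF y]
      by (intro nn_integral_exp_neg_log_densities[of _ "Mtr (\<Lambda> y)"])
         (auto intro: prob_space_imp_sigma_finite)
  qed
  \<comment> \<open>\<open>Msing\<close> is not assumed to be a kernel. By \<open>exp_int\<close>
    this function agrees with \<open>l\<close> on \<open>MY\<close>, and it is measurable because
    \<open>Mcond\<close> is a kernel.\<close>
  have "(\<lambda>y. 1 - enn2real (\<integral>\<^sup>+ x. e2ennreal (exp_ereal (- \<sigma> y x - I y x)) \<partial>Mcond y)) \<in> borel_measurable MY"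
    by (intro borel_measurable_diff borel_measurable_const borel_measurable_enn2real
      nn_integral_measurable_subprob_algebra2[OF _ Ksub]) measurable
  then have l_meas [measurable]: "l \<in> borel_measurable MY"
    by (rule measurable_cong[THEN iffD1, rotated]) (simp add: exp_int l01)
  have l_measQ: "l \<in> borel_measurable Q" by measurable
  have Iu_meas [measurable]: "(\<lambda>y. unavailable_info (Msing y)) \<in> borel_measurable Q"
    unfolding Iu ln_ereal_def by measurable

  have jarzynski: "(\<integral>\<^sup>+ x. e2ennreal (exp_ereal (- \<sigma> y x - I y x + unavailable_info (Msing y))) \<partial>Mcond y) = 1"
    if y: "y \<in> space MY" and lt: "l y < 1" for y
  proof -
    note [measurable] = slice[OF y]
    have fin: "unavailable_info (Msing y) = ereal (- ln (1 - l y))"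
      using lt by (simp add: Iu ln_ereal_def)
    have sp: "space (Mcond y) = space MX" "space (Mtr (\<Lambda> y)) = space MX"
      using K(2)[OF y] assms(6)[OF y] by (metis sets_eq_imp_space_eq)+
    have "(\<integral>\<^sup>+ x. e2ennreal (exp_ereal (- \<sigma> y x - I y x + unavailable_info (Msing y))) \<partial>Mcond y)
      = (\<integral>\<^sup>+ x. e2ennreal (exp_ereal (- \<sigma> y x - I y x)) * ennreal (1 / (1 - l y)) \<partial>Mcond y)"
    proof (intro nn_integral_cong)
      fix x assume "x \<in> space (Mcond y)"
      then have "\<sigma> y x \<noteq> -\<infinity>" "I y x \<noteq> -\<infinity>"
        using assms(13,14)[OF y] sp by (auto simp: neg_log_density_def)
      then have "- \<sigma> y x - I y x \<noteq> \<infinity>" by (cases "\<sigma> y x"; cases "I y x") auto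
      then show "e2ennreal (exp_ereal (- \<sigma> y x - I y x + unavailable_info (Msing y)))
        = e2ennreal (exp_ereal (- \<sigma> y x - I y x)) * ennreal (1 / (1 - l y))"
        using lt by (subst exp_ereal_add) (auto simp: fin exp_ereal_def[of "ereal _"] exp_minus inverse_eq_divide)
    qed
    also have "\<dots> = ennreal (1 - l y) * ennreal (1 / (1 - l y))"
      by (simp add: nn_integral_multc exp_int[OF y])
    also have "\<dots> = 1" using lt by (simp flip: ennreal_mult)
    finally show ?thesis .
  qed
  have avg_exp: "avg (Mcond y) (\<lambda>x. exp_ereal (- \<sigma> y x - I y x + unavailable_info (Msing y))) = 1"
    if "y \<in> space MY" "l y < 1" for y
    using jarzynski[OF that] by (simp add: avg_nonneg_eq one_ennreal.rep_eq)

  \<comment> \<open>The second law for a fixed outcome\<close>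
  have second_law: "- avg (Mcond y) (\<lambda>x. I y x - unavailable_info (Msing y)) \<le> avg (Mcond y) (\<sigma> y)"
    if y: "y \<in> space MY" and lt: "l y < 1" for y
  proof -
    interpret K: prob_space "Mcond y" by (rule K(1)[OF y])
    note [measurable] = slice[OF y]
    \<comment> \<open>By \<open>lt\<close> the shift is finite, so it can be moved out of the
      difference even where \<open>a\<close> or \<open>b\<close> is infinite.\<close>
    have "- a - (b - unavailable_info (Msing y)) = - a - b + unavailable_info (Msing y)" for a b
      using lt by (cases a; cases b) (auto simp: Iu ln_ereal_def)
    then show ?thesis
      using jarzynski[OF that] by (intro K.avg_ge_uminus_avg) auto
  qed

  \<comment> \<open>Average mutual information for a fixed outcome and its shift\<close>
  have I_exp: "(\<integral>\<^sup>+ x. e2ennreal (exp_ereal (- I y x)) \<partial>Mcond y) = 1" if y: "y \<in> space MY" for y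
    using nn_integral_neg_log_density[OF _ assms(10)[OF y] _ assms(14)[OF y], of "\<lambda>_. 1"]
      K[OF y] assms(6)[OF y]
    by (simp add: prob_space_imp_sigma_finite prob_space.emeasure_space_1)
  have I_nonneg: "0 \<le> avg (Mcond y) (I y)" if y: "y \<in> space MY" for y
  proof -
    interpret K: prob_space "Mcond y" by (rule K(1)[OF y])
    \<comment> \<open>Gibbs' inequality: the average of \<open>I y\<close> is the relative entropy
      of \<open>Mcond y\<close> with respect to \<open>Mtr (\<Lambda> y)\<close>. It is the
      second-law inequality with \<open>g = 0\<close>, whose exponential hypothesis is
      \<open>I_exp\<close>.\<close>
    have "- avg (Mcond y) (\<lambda>x. 0) \<le> avg (Mcond y) (I y)"
      using slice[OF y] I_exp[OF y] by (intro K.avg_ge_uminus_avg) auto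
    then show ?thesis by (simp add: K.avg_const)
  qed
  have I_shift: "avg (Mcond y) (\<lambda>x. I y x - unavailable_info (Msing y))
      \<le> avg (Mcond y) (I y) - unavailable_info (Msing y)" if y: "y \<in> space MY" for y
  proof -
    interpret K: prob_space "Mcond y" by (rule K(1)[OF y])
    \<comment> \<open>The negative part of \<open>I y\<close> lies below its exponential, of
      integral 1; this supplies the finiteness that \<open>avg_diff_le\<close> asks for.\<close>
    have "(\<integral>\<^sup>+ x. e2ennreal (- I y x) \<partial>Mcond y) \<le> (\<integral>\<^sup>+ x. e2ennreal (exp_ereal (- I y x)) \<partial>Mcond y)"
      using e2ennreal_uminus_le_exp[of _ 0] by (intro nn_integral_mono) simp
    also have "\<dots> < \<infinity>" using I_exp[OF y] by simp
    finally show ?thesis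
      using avg_diff_le[OF slice(2)[OF y], of "\<lambda>_. unavailable_info (Msing y)"] Iu_nonneg[OF y]
      by (simp add: K.avg_const)
  qed
  have [measurable]: "(\<lambda>y. \<integral>\<^sup>+ x. e2ennreal (I y x) \<partial>Mcond y) \<in> borel_measurable MY"
    "(\<lambda>y. \<integral>\<^sup>+ x. e2ennreal (- I y x) \<partial>Mcond y) \<in> borel_measurable MY"
    by (intro nn_integral_measurable_subprob_algebra2[OF _ Ksub]; measurable)+
  have I_meas: "(\<lambda>y. avg (Mcond y) (I y)) \<in> borel_measurable Q"
    unfolding avg_def by measurable

  \<comment> \<open>Averaging over the outcomes\<close>
  have jensen: "- ln_ereal (1 - (\<integral>y. l y \<partial>Q)) \<le> avg Q (\<lambda>y. - ln_ereal (1 - l y))"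
    using l01 spQ by (intro Q.ln_ereal_jensen l_measQ) auto

  have Iu_full: "full_avg Q Mcond (\<lambda>y x. unavailable_info (Msing y)) = avg Q (\<lambda>y. - ln_ereal (1 - l y))"
    unfolding full_avg_def Iu using K(1) spQ
    by (intro avg_cong_AE AE_I2) (simp add: prob_space.avg_const)

  have full_exp: "full_avg Q Mcond (\<lambda>y x. exp_ereal (- \<sigma> y x - I y x + unavailable_info (Msing y))) = 1"
    if lt: "AE y in Q. l y < 1"
  proof -
    have "full_avg Q Mcond (\<lambda>y x. exp_ereal (- \<sigma> y x - I y x + unavailable_info (Msing y))) = avg Q (\<lambda>_. 1)"
      unfolding full_avg_def
      by (rule avg_cong_AE) (use lt AE_space[of Q] in \<open>eventually_elim, simp add: avg_exp spQ\<close>)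
    then show ?thesis by (simp add: Q.avg_const)
  qed

  have full_second_law: "- full_avg Q Mcond (\<lambda>y x. I y x - unavailable_info (Msing y)) \<le> full_avg Q Mcond \<sigma>"
    if lt: "AE y in Q. l y < 1"
  proof -
    have "- full_avg Q Mcond (\<lambda>y x. I y x - unavailable_info (Msing y))
        \<le> avg Q (\<lambda>y. - avg (Mcond y) (\<lambda>x. I y x - unavailable_info (Msing y)))"
      unfolding full_avg_def by (rule uminus_avg_le)
    also have "\<dots> \<le> full_avg Q Mcond \<sigma>"
      unfolding full_avg_def
      by (rule avg_mono_AE) (use lt AE_space[of Q] in \<open>eventually_elim, simp add: second_law spQ\<close>)
    finally show ?thesis .
  qed

  have stronger: "- full_avg Q Mcond I - ln_ereal (1 - (\<integral>y. l y \<partial>Q))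
      \<le> - full_avg Q Mcond (\<lambda>y x. I y x - unavailable_info (Msing y))"
    if lt: "AE y in Q. l y < 1"
  proof -
    \<comment> \<open>A mean of \<open>l\<close> below 1 makes the logarithm a finite number
      \<open>d\<close>; the negation can then be distributed over the difference even if the average
      of \<open>I\<close> is infinite.\<close>
    have "integrable Q l" using l01 spQ l_measQ by (intro Q.integrable_const_bound[where B=1]) auto
    then have "(\<integral>y. l y \<partial>Q) < 1" using lt by (rule Q.expectation_less)
    then obtain d where d: "- ln_ereal (1 - (\<integral>y. l y \<partial>Q)) = ereal d"
      by (auto simp: ln_ereal_def)
    have "full_avg Q Mcond (\<lambda>y x. I y x - unavailable_info (Msing y))
        \<le> avg Q (\<lambda>y. avg (Mcond y) (I y) - unavailable_info (Msing y))"
      unfolding full_avg_def by (intro avg_mono_AE AE_I2 I_shift) (simp add: spQ)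
    also have "\<dots> \<le> full_avg Q Mcond I - avg Q (\<lambda>y. - ln_ereal (1 - l y))"
      unfolding full_avg_def Iu[symmetric]
    proof (rule avg_diff_le[OF I_meas Iu_meas])
      \<comment> \<open>The average over each outcome is nonnegative by \<open>I_nonneg\<close>, so
        the negative part vanishes and \<open>avg_diff_le\<close> applies at the outer level
        too.\<close>
      have "(\<integral>\<^sup>+ y. e2ennreal (- avg (Mcond y) (I y)) \<partial>Q) = (\<integral>\<^sup>+ y. 0 \<partial>Q)"
        using I_nonneg spQ by (intro nn_integral_cong) (simp add: e2ennreal_neg)
      then show "(\<integral>\<^sup>+ y. e2ennreal (- avg (Mcond y) (I y)) \<partial>Q) < \<infinity>" by simp
    qed (simp add: Iu_nonneg spQ)
    also have "\<dots> \<le> full_avg Q Mcond I - ereal d"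
      using jensen d by (intro ereal_minus_mono) auto
    finally have "- (full_avg Q Mcond I - ereal d)
        \<le> - full_avg Q Mcond (\<lambda>y x. I y x - unavailable_info (Msing y))" by simp
    moreover have "- (full_avg Q Mcond I - ereal d) = - full_avg Q Mcond I - ln_ereal (1 - (\<integral>y. l y \<partial>Q))"
      unfolding minus_ereal_def d by (cases "full_avg Q Mcond I") auto
    ultimately show ?thesis by simp
  qed

  show ?thesis
    unfolding l_def[symmetric]
    by (intro conjI ballI impI Iu_nonneg avg_exp full_exp full_second_law stronger Iu_full jensen)
qed

end
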